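(* Let $\mathcal G=(\mathcal V,\mathcal E)$ be a strongly connected directed graph without self loops, with node set $\mathcal V=\{1,\dots,n\}$, $n\ge 2$, and adjacency matrix $A=[a_{ij}]_{i,j=1}^n$ ($a_{ij}=1$ if $(i,j)\in\mathcal E$, and $a_{ij}=0$ otherwise). Let $\lambda_A>0$ be the Frobenius-Perron eigenvalue of $A$ and let $\varphi$ be a corresponding right Frobenius-Perron eigenvector, i.e. $A\varphi=\lambda_A\varphi$ with all entries $\varphi_i>0$. Define $$Q^{\rm RB}=\operatorname{diag}(\varphi)^{-1}A\operatorname{diag}(\varphi)-\lambda_A I .$$ For an infinitesimal generator $Q=[q_{ij}]_{i,j=1}^n$ consistent with the topology of $\mathcal G$, with invariant probability measure $\pi$, let $$h_1(Q)=-\sum_{i}\pi_i q_{ii}-\sum_{i\ne j}\pi_i q_{ij}\log q_{ij}.$$ Then, over all infinitesimal generators consistent with the topology of $\mathcal G$, $h_1$ attains its maximum at exactly one generator, namely $Q^{\rm RB}$. Moreover, $$h_1(Q^{\rm RB})=\lambda_A .$$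
   Context: An infinitesimal generator on $\{1,\dots,n\}$ is a real matrix $Q=[q_{ij}]$ with $q_{ij}\ge 0$ for $i\neq j$, $q_{ii}<0$ for every $i$, and $Q\mathbb 1=0$ (zero row sums); it generates the time-homogeneous Markov jump process with transition matrix $\exp(Qt)$. The chain is assumed ergodic: $(\exp(Qt))_{ij}>0$ for all $i,j$ and all $t>0$. Hence it has a unique invariant probability measure $\pi$ (a column vector with $Q'\pi=0$, $\sum_i\pi_i=1$, where $'$ denotes transposition). Such a $Q$ is consistent with the topology of the graph with adjacency matrix $A$ if, for $i\ne j$, $q_{ij}=0$ whenever $a_{ij}=0$. Convention: $0\log 0=0$. The Frobenius-Perron eigenvalue $\lambda_A$ of $A$ is its spectral radius, and $\operatorname{diag}(\varphi)$ is the diagonal matrix with diagonal entries $\varphi_i$; $Q^{\rm RB}$ does not depend on the scaling of $\varphi$. *)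

theory Defs
  imports "HOL-Analysis.Analysis"
begin

text \<open>
  Nodes are the elements of a finite type \<open>'n\<close>, so \<open>n = CARD('n)\<close>. A directed graph on this node
  set is an edge relation \<open>E :: 'n rel\<close>, and it has no self loops iff \<open>irrefl E\<close>.
\<close>

definition strongly_connected :: "'n rel \<Rightarrow> bool" where
  "strongly_connected E \<longleftrightarrow> (\<forall>i j. (i, j) \<in> E\<^sup>*)"

definition adjacency_matrix :: "'n rel \<Rightarrow> real^'n^'n" where
  "adjacency_matrix E = (\<chi> i j. if (i, j) \<in> E then 1 else 0)"

definition eigenvalue :: "'a::field^'n^'n \<Rightarrow> 'a \<Rightarrow> bool" where
  "eigenvalue M k \<longleftrightarrow> (\<exists>v. v \<noteq> 0 \<and> M *v v = k *s v)"

text \<open>The spectrum of a real matrix is taken over the complex numbers.\<close>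

definition spectral_radius :: "real^'n^'n \<Rightarrow> real" where
  "spectral_radius M = (SUP k\<in>{k. eigenvalue (map_matrix complex_of_real M) k}. cmod k)"

definition diag :: "real^'n \<Rightarrow> real^'n^'n" where
  "diag v = (\<chi> i j. if i = j then v $ i else 0)"

text \<open>
  The multiplication of the type class instance on \<open>real^'n^'n\<close> is the componentwise one, so
  neither \<open>^\<close> nor \<open>exp\<close> from the library refers to the matrix product.
\<close>

definition matrix_power :: "real^'n^'n \<Rightarrow> nat \<Rightarrow> real^'n^'n" where
  "matrix_power M k = ((**) M ^^ k) (mat 1)"

definition matrix_exp :: "real^'n^'n \<Rightarrow> real^'n^'n" where
  "matrix_exp M = (\<Sum>k. (1 / fact k) *\<^sub>R matrix_power M k)"

definition infinitesimal_generator :: "real^'n^'n \<Rightarrow> bool" where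
  "infinitesimal_generator Q \<longleftrightarrow>
     (\<forall>i j. i \<noteq> j \<longrightarrow> Q $ i $ j \<ge> 0) \<and> (\<forall>i. Q $ i $ i < 0) \<and> Q *v 1 = 0"

definition ergodic :: "real^'n^'n \<Rightarrow> bool" where
  "ergodic Q \<longleftrightarrow> (\<forall>i j. \<forall>t>0. matrix_exp (t *\<^sub>R Q) $ i $ j > 0)"

definition consistent :: "real^'n^'n \<Rightarrow> real^'n^'n \<Rightarrow> bool" where
  "consistent A Q \<longleftrightarrow> (\<forall>i j. i \<noteq> j \<longrightarrow> A $ i $ j = 0 \<longrightarrow> Q $ i $ j = 0)"

text \<open>Ergodicity is a standing assumption on every generator considered.\<close>

definition graph_generators :: "real^'n^'n \<Rightarrow> (real^'n^'n) set" where
  "graph_generators A = {Q. infinitesimal_generator Q \<and> ergodic Q \<and> consistent A Q}"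

definition is_invariant_probability :: "real^'n^'n \<Rightarrow> real^'n \<Rightarrow> bool" where
  "is_invariant_probability Q p \<longleftrightarrow>
     (\<forall>i. p $ i \<ge> 0) \<and> (\<Sum>i\<in>UNIV. p $ i) = 1 \<and> transpose Q *v p = 0"

text \<open>Existence and uniqueness hold for every ergodic infinitesimal generator.\<close>

definition invariant_probability :: "real^'n^'n \<Rightarrow> real^'n" where
  "invariant_probability Q = (THE p. is_invariant_probability Q p)"

text \<open>Since \<open>ln 0 = 0\<close>, the convention \<open>0 log 0 = 0\<close> needs no case distinction.\<close>

definition h1 :: "real^'n^'n \<Rightarrow> real" where
  "h1 Q = (let p = invariant_probability Q in
     - (\<Sum>i\<in>UNIV. p $ i * Q $ i $ i)
     - (\<Sum>(i, j)\<in>{(i, j). i \<noteq> j}. p $ i * Q $ i $ j * ln (Q $ i $ j)))"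

definition Q_RB :: "real^'n^'n \<Rightarrow> real^'n \<Rightarrow> real^'n^'n" where
  "Q_RB A \<phi> = matrix_inv (diag \<phi>) ** A ** diag \<phi> - spectral_radius A *\<^sub>R mat 1"

end

theory Submission
  imports Defs
begin

text \<open>
  Write \<open>r\<^sub>i\<^sub>j = a\<^sub>i\<^sub>j \<phi>\<^sub>j / \<phi>\<^sub>i\<close> for the off-diagonal rates of \<open>Q\<^sup>R\<^sup>B\<close>. Invariance of \<open>\<pi>\<close> gives
  \<open>\<Sum>\<^sub>i\<^sub>,\<^sub>j \<pi>\<^sub>i q\<^sub>i\<^sub>j (ln \<phi>\<^sub>j - ln \<phi>\<^sub>i) = 0\<close>, so \<open>h\<^sub>1(Q) = \<Sum> \<pi>\<^sub>i q\<^sub>i\<^sub>j (1 - ln (q\<^sub>i\<^sub>j / r\<^sub>i\<^sub>j))\<close>, the sum being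
  over the edges. Since \<open>q (1 - ln (q / r)) \<le> r\<close> with equality only at \<open>q = r\<close>, and the row sums of
  \<open>r\<close> are \<open>\<lambda>\<^sub>A\<close>, the value is at most \<open>\<lambda>\<^sub>A\<close>; as \<open>\<pi>\<close> is positive, it is attained only for \<open>q = r\<close>.
\<close>

section \<open>The matrix exponential\<close>

lemma matrix_power_0 [simp]: "matrix_power M 0 = mat 1"
  by (simp add: matrix_power_def)

lemma matrix_power_Suc: "matrix_power M (Suc k) = M ** matrix_power M k"
  by (simp add: matrix_power_def)

text \<open>The sum of all absolute entries dominates every absolute row sum, so each multiplication
  by \<open>M\<close> costs at most one factor \<open>?c\<close>. The bound is crude, but it lets
  the scalar exponential series at \<open>?c\<close> majorise every entry series.\<close>

lemma matrix_power_nth_bound: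
  fixes M :: "real^'n^'n"
  shows "\<bar>matrix_power M k $ i $ j\<bar> \<le> (\<Sum>i\<in>UNIV. \<Sum>j\<in>UNIV. \<bar>M $ i $ j\<bar>) ^ k"
    (is "_ \<le> ?c ^ k")
proof (induction k arbitrary: i)
  case 0
  show ?case by (simp add: mat_def)
next
  case (Suc k)
  have row: "(\<Sum>l\<in>UNIV. \<bar>M $ i $ l\<bar>) \<le> ?c"
    by (rule member_le_sum[of i UNIV "\<lambda>i. \<Sum>l\<in>UNIV. \<bar>M $ i $ l\<bar>"]) (auto intro: sum_nonneg)
  have "\<bar>matrix_power M (Suc k) $ i $ j\<bar> = \<bar>\<Sum>l\<in>UNIV. M $ i $ l * matrix_power M k $ l $ j\<bar>"
    by (simp add: matrix_power_Suc matrix_matrix_mult_def)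
  also have "\<dots> \<le> (\<Sum>l\<in>UNIV. \<bar>M $ i $ l\<bar> * \<bar>matrix_power M k $ l $ j\<bar>)"
    using sum_abs[of "\<lambda>l. M $ i $ l * matrix_power M k $ l $ j" UNIV] by (simp add: abs_mult)
  also have "\<dots> \<le> (\<Sum>l\<in>UNIV. \<bar>M $ i $ l\<bar> * ?c ^ k)"
    by (intro sum_mono mult_left_mono Suc) auto
  also have "\<dots> = (\<Sum>l\<in>UNIV. \<bar>M $ i $ l\<bar>) * ?c ^ k"
    by (simp add: sum_distrib_right)
  also have "\<dots> \<le> ?c * ?c ^ k"
    by (intro mult_right_mono row zero_le_power sum_nonneg) auto
  finally show ?case by simp
qed

lemma summable_abs_matrix_exp_nth:
  fixes M :: "real^'n^'n"
  shows "summable (\<lambda>k. \<bar>matrix_power M k $ i $ j / fact k\<bar>)"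
proof (rule summable_comparison_test)
  let ?c = "\<Sum>i\<in>UNIV. \<Sum>j\<in>UNIV. \<bar>M $ i $ j\<bar>"
  show "\<exists>N. \<forall>k\<ge>N. norm \<bar>matrix_power M k $ i $ j / fact k\<bar> \<le> inverse (fact k) * ?c ^ k"
    using matrix_power_nth_bound[of M _ i j] by (auto simp: field_simps)
  show "summable (\<lambda>k. inverse (fact k) * ?c ^ k)"
    by (rule summable_exp)
qed

text \<open>Convergence in \<open>real^'n^'n\<close> is componentwise, so the entry series determine
  \<open>matrix_exp\<close>. This reduces all later work on the exponential to real series.\<close>

lemma matrix_exp_nth_sums:
  fixes M :: "real^'n^'n"
  shows "(\<lambda>k. matrix_power M k $ i $ j / fact k) sums (matrix_exp M $ i $ j)"
proof -
  define L :: "real^'n^'n" where "L = (\<chi> i j. \<Sum>k. matrix_power M k $ i $ j / fact k)"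
  have nth: "(\<lambda>k. matrix_power M k $ i $ j / fact k) sums (L $ i $ j)" for i j
    unfolding L_def using summable_rabs_cancel[OF summable_abs_matrix_exp_nth[of M i j]]
    by (simp add: summable_sums)
  have "(\<lambda>k. (1 / fact k) *\<^sub>R matrix_power M k) sums L"
    unfolding sums_def
    by (intro vec_tendstoI) (use nth in \<open>simp add: sums_def sum_component\<close>)
  then have "matrix_exp M = L"
    unfolding matrix_exp_def by (rule sums_unique[symmetric])
  with nth show ?thesis by simp
qed

text \<open>Every power beyond the zeroth kills \<open>x\<close>, so only the identity term of the
  series survives. With \<open>x = 1\<close> this makes the exponential of a generator have unit row
  sums.\<close>

lemma matrix_exp_fixes_kernel:
  fixes M :: "real^'n^'n"
  assumes "M *v x = 0"
  shows "matrix_exp M *v x = x"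
proof -
  have pow: "matrix_power M (Suc k) *v x = 0" for k
    by (induction k)
      (simp_all add: matrix_power_Suc assms flip: matrix_vector_mul_assoc)
  have "(matrix_exp M *v x) $ i = x $ i" for i
  proof -
    have "(\<lambda>k. \<Sum>j\<in>UNIV. matrix_power M k $ i $ j / fact k * x $ j) sums (matrix_exp M *v x) $ i"
      unfolding matrix_vector_mult_def
      by (simp only: vec_lambda_beta) (intro sums_sum sums_mult2 matrix_exp_nth_sums)
    also have "(\<lambda>k. \<Sum>j\<in>UNIV. matrix_power M k $ i $ j / fact k * x $ j) =
        (\<lambda>k. (matrix_power M k *v x) $ i / fact k)"
      by (simp add: matrix_vector_mult_def sum_divide_distrib)
    also have "\<dots> = (\<lambda>k. if k = 0 then x $ i else 0)"
      using pow by (auto simp: fun_eq_iff gr0_conv_Suc)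
    finally show ?thesis
      using sums_unique2 sums_single[of 0 "\<lambda>_. x $ i"] by fastforce
  qed
  then show ?thesis by (simp add: vec_eq_iff)
qed

text \<open>The row-vector analogue: it turns stationarity for the generator into a fixed-point
  equation for its exponential.\<close>

lemma matrix_exp_fixes_left_kernel:
  fixes M :: "real^'n^'n"
  assumes "x v* M = 0"
  shows "x v* matrix_exp M = x"
proof -
  have pow: "x v* matrix_power M (Suc k) = 0" for k
    by (simp add: matrix_power_Suc assms flip: vector_matrix_mul_assoc)
  have "(x v* matrix_exp M) $ j = x $ j" for j
  proof -
    have "(\<lambda>k. \<Sum>i\<in>UNIV. x $ i * (matrix_power M k $ i $ j / fact k)) sums (x v* matrix_exp M) $ j"
      unfolding vector_matrix_mult_def
      by (simp only: vec_lambda_beta) (intro sums_sum sums_mult matrix_exp_nth_sums)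
    also have "(\<lambda>k. \<Sum>i\<in>UNIV. x $ i * (matrix_power M k $ i $ j / fact k)) =
        (\<lambda>k. (x v* matrix_power M k) $ j / fact k)"
      by (simp add: vector_matrix_mult_def sum_divide_distrib)
    also have "\<dots> = (\<lambda>k. if k = 0 then x $ j else 0)"
      using pow by (auto simp: fun_eq_iff gr0_conv_Suc)
    finally show ?thesis
      using sums_unique2 sums_single[of 0 "\<lambda>_. x $ j"] by fastforce
  qed
  then show ?thesis by (simp add: vec_eq_iff)
qed

section \<open>Scalar shifts and positivity of the exponential\<close>

text \<open>The binomial theorem for \<open>M\<close> and the commuting matrix
  \<open>c *\<^sub>R mat 1\<close>, divided by \<open>fact k\<close> so that the right-hand side is
  a Cauchy product coefficient.\<close>

lemma matrix_power_add_scalar: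
  fixes M :: "real^'n^'n"
  shows "matrix_power (M + c *\<^sub>R mat 1) k $ i $ j / fact k =
    (\<Sum>l\<le>k. (matrix_power M l $ i $ j / fact l) * (c ^ (k - l) / fact (k - l)))"
proof (induction k arbitrary: i)
  case 0
  show ?case by simp
next
  case (Suc k)
  define S where "S = (\<lambda>l i. matrix_power M l $ i $ j / fact l)"
  define d where "d = (\<lambda>l. c ^ l / fact l)"
  \<comment> \<open>Both factors obey the recurrence of exponential coefficients: multiplying the
    \<open>l\<close>-th one by \<open>M\<close> or \<open>c\<close> gives \<open>Suc l\<close> times
    the next one.\<close>
  have S: "(\<Sum>m\<in>UNIV. M $ i $ m * S l m) = real (Suc l) * S (Suc l) i" for l
  proof -
    have "(\<Sum>m\<in>UNIV. M $ i $ m * S l m) = matrix_power M (Suc l) $ i $ j / fact l"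
      by (simp add: S_def matrix_power_Suc matrix_matrix_mult_def sum_divide_distrib)
    then show ?thesis
      by (simp add: S_def divide_simps del: of_nat_Suc)
  qed
  have d: "c * d l = real (Suc l) * d (Suc l)" for l
    by (simp add: d_def divide_simps del: of_nat_Suc)
  have "matrix_power (M + c *\<^sub>R mat 1) (Suc k) $ i $ j / fact k =
      (\<Sum>m\<in>UNIV. (M + c *\<^sub>R mat 1) $ i $ m * (\<Sum>l\<le>k. S l m * d (k - l)))"
    unfolding S_def d_def Suc[symmetric]
    by (simp add: matrix_power_Suc matrix_matrix_mult_def sum_divide_distrib)
  also have "\<dots> = (\<Sum>m\<in>UNIV. \<Sum>l\<le>k. M $ i $ m * S l m * d (k - l)) + c * (\<Sum>l\<le>k. S l i * d (k - l))"
  proof -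
    have "(\<Sum>m\<in>UNIV. c * (mat 1 :: real^'n^'n) $ i $ m * (\<Sum>l\<le>k. S l m * d (k - l))) =
       (\<Sum>m\<in>UNIV. if m = i then c * (\<Sum>l\<le>k. S l m * d (k - l)) else 0)"
      by (intro sum.cong) (auto simp: mat_def)
    then show ?thesis
      by (simp add: distrib_right sum.distrib sum_distrib_left mult.assoc)
  qed
  also have "(\<Sum>m\<in>UNIV. \<Sum>l\<le>k. M $ i $ m * S l m * d (k - l)) =
      (\<Sum>l\<le>k. real (Suc l) * S (Suc l) i * d (k - l))"
    by (subst sum.swap) (simp only: S flip: sum_distrib_right)
  \<comment> \<open>After the index shift the range starts at 0; the added term vanishes through the
    factor \<open>real l\<close>.\<close>
  also have "\<dots> = (\<Sum>l\<le>Suc k. real l * S l i * d (Suc k - l))"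
    by (subst sum.atMost_Suc_shift) simp
  also have "c * (\<Sum>l\<le>k. S l i * d (k - l)) = (\<Sum>l\<le>k. real (Suc k - l) * (S l i * d (Suc k - l)))"
    unfolding sum_distrib_left
  proof (rule sum.cong)
    fix l assume "l \<in> {..k}"
    then show "c * (S l i * d (k - l)) = real (Suc k - l) * (S l i * d (Suc k - l))"
      using d[of "k - l"] by (simp only: Suc_diff_le atMost_iff) (metis mult.left_commute)
  qed simp
  \<comment> \<open>The added term \<open>l = Suc k\<close> has weight 0. Both sums now share one
    range, and their weights add up to \<open>Suc k\<close>.\<close>
  also have "\<dots> = (\<Sum>l\<le>Suc k. real (Suc k - l) * (S l i * d (Suc k - l)))"
    by simp
  also have "(\<Sum>l\<le>Suc k. real l * S l i * d (Suc k - l)) + \<dots> =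
      (\<Sum>l\<le>Suc k. real (Suc k) * (S l i * d (Suc k - l)))"
    unfolding sum.distrib[symmetric]
  proof (rule sum.cong)
    fix l assume "l \<in> {..Suc k}"
    then have "real (Suc k) = real l + real (Suc k - l)"
      by simp
    then show "real l * S l i * d (Suc k - l) + real (Suc k - l) * (S l i * d (Suc k - l)) =
        real (Suc k) * (S l i * d (Suc k - l))"
      by (metis distrib_right mult.assoc)
  qed simp
  finally have "matrix_power (M + c *\<^sub>R mat 1) (Suc k) $ i $ j / fact k =
      real (Suc k) * (\<Sum>l\<le>Suc k. S l i * d (Suc k - l))"
    by (simp only: sum_distrib_left)
  then have "matrix_power (M + c *\<^sub>R mat 1) (Suc k) $ i $ j / fact (Suc k) =
      (\<Sum>l\<le>Suc k. S l i * d (Suc k - l))"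
    by (simp only: fact_Suc divide_divide_eq_left[symmetric] mult.commute[of "real (Suc k)" "fact k"])
      (simp del: of_nat_Suc sum.atMost_Suc)
  then show ?case
    unfolding S_def d_def .
qed

text \<open>The Cauchy product of the two absolutely convergent series. It allows the negative
  diagonal of a generator to be shifted away at the price of a positive factor.\<close>

lemma matrix_exp_add_scalar:
  fixes M :: "real^'n^'n"
  shows "matrix_exp (M + c *\<^sub>R mat 1) = exp c *\<^sub>R matrix_exp M"
proof -
  have "matrix_exp (M + c *\<^sub>R mat 1) $ i $ j = exp c * matrix_exp M $ i $ j" for i j
  proof -
    have c: "(\<lambda>k. c ^ k / fact k) sums exp c"
      using exp_converges[of c] by (simp add: field_simps)
    have "summable (\<lambda>k. norm (c ^ k / fact k))"
      using summable_norm_exp[of c] by (simp add: field_simps)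
    then have "(\<lambda>k. \<Sum>l\<le>k. (matrix_power M l $ i $ j / fact l) * (c ^ (k - l) / fact (k - l)))
        sums ((\<Sum>k. matrix_power M k $ i $ j / fact k) * (\<Sum>k. c ^ k / fact k))"
      by (intro Cauchy_product_sums) (use summable_abs_matrix_exp_nth[of M i j] in simp_all)
    then have "(\<lambda>k. matrix_power (M + c *\<^sub>R mat 1) k $ i $ j / fact k) sums
        (matrix_exp M $ i $ j * exp c)"
      unfolding matrix_power_add_scalar sums_unique[OF matrix_exp_nth_sums, symmetric]
        sums_unique[OF c, symmetric] .
    from sums_unique2[OF this matrix_exp_nth_sums] show ?thesis
      by (simp add: mult.commute)
  qed
  then show ?thesis by (simp add: vec_eq_iff)
qed

text \<open>A path of length \<open>k\<close> along positive entries makes the corresponding entry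
  of the \<open>k\<close>-th power positive, and no other term of the series can cancel it.\<close>

lemma matrix_exp_nonneg_irreducible_pos:
  fixes M :: "real^'n^'n"
  assumes nonneg: "\<And>i j. M $ i $ j \<ge> 0"
    and path: "(i, j) \<in> {(i, j). M $ i $ j > 0}\<^sup>*"
  shows "matrix_exp M $ i $ j > 0"
proof -
  have pow_nonneg: "matrix_power M k $ i $ j \<ge> 0" for k i j
    by (induction k arbitrary: i)
      (auto simp: mat_def matrix_power_Suc matrix_matrix_mult_def nonneg intro!: sum_nonneg)
  have "\<exists>k. matrix_power M k $ i $ j > 0"
    using path
  proof (induction rule: converse_rtrancl_induct)
    case base
    have "matrix_power M 0 $ j $ j > 0" by (simp add: mat_def)
    then show ?case by blast
  next
    case (step i l)
    then obtain k where "matrix_power M k $ l $ j > 0" by blast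
    with step(1) have "M $ i $ l * matrix_power M k $ l $ j > 0" by simp
    then have "matrix_power M (Suc k) $ i $ j > 0"
      unfolding matrix_power_Suc matrix_matrix_mult_def
      by (auto intro!: sum_pos2[of UNIV l] mult_nonneg_nonneg nonneg pow_nonneg)
    then show ?case by blast
  qed
  then obtain k where "matrix_power M k $ i $ j > 0" by blast
  then have "matrix_power M k $ i $ j / fact k > 0" by simp
  then have "(\<Sum>k. matrix_power M k $ i $ j / fact k) > 0"
    by (intro suminf_pos2[of _ k] sums_summable[OF matrix_exp_nth_sums]) (simp_all add: pow_nonneg)
  then show ?thesis
    by (simp add: sums_unique[OF matrix_exp_nth_sums])
qed

section \<open>Invariant probabilities\<close>

text \<open>
  The positive part of a left fixed vector is again one: it is dominated by its image, and the
  total masses agree.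
\<close>

lemma positive_stochastic_fixed_vector_pos:
  fixes P :: "real^'n^'n"
  assumes pos: "\<And>i j. P $ i $ j > 0" and one: "P *v 1 = 1"
    and fixed: "v v* P = v" and "v $ a > 0"
  shows "v $ b > 0"
proof -
  define w where "w i = max (v $ i) 0" for i
  have w_nonneg: "w i \<ge> 0" for i by (simp add: w_def)
  have row: "(\<Sum>j\<in>UNIV. P $ i $ j) = 1" for i
    using one by (simp add: vec_eq_iff matrix_vector_mult_def)
  have v: "v $ j = (\<Sum>i\<in>UNIV. P $ i $ j * v $ i)" for j
    using fixed by (simp add: vec_eq_iff vector_matrix_mult_def mult.commute)
  have le: "w j \<le> (\<Sum>i\<in>UNIV. P $ i $ j * w i)" for j
  proof -
    have "v $ j \<le> (\<Sum>i\<in>UNIV. P $ i $ j * w i)"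
      unfolding v[of j] by (intro sum_mono mult_left_mono) (auto simp: w_def pos less_imp_le)
    moreover have "0 \<le> (\<Sum>i\<in>UNIV. P $ i $ j * w i)"
      by (intro sum_nonneg mult_nonneg_nonneg w_nonneg less_imp_le pos)
    ultimately show ?thesis by (simp add: w_def)
  qed
  have "(\<Sum>j\<in>UNIV. (\<Sum>i\<in>UNIV. P $ i $ j * w i) - w j) = 0"
    unfolding sum_subtractf by (subst sum.swap) (simp add: row flip: sum_distrib_right)
  then have "w b = (\<Sum>i\<in>UNIV. P $ i $ b * w i)"
    using le by (subst (asm) sum_nonneg_eq_0_iff) auto
  also have "\<dots> > 0"
    by (rule sum_pos2[of UNIV a]) (use assms(4) in \<open>auto simp: w_def pos less_imp_le\<close>)
  finally show ?thesis by (simp add: w_def split: if_splits)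
qed

lemma sum_neg:
  fixes f :: "'a \<Rightarrow> real"
  assumes "finite I" "I \<noteq> {}" "\<And>i. i \<in> I \<Longrightarrow> f i < 0"
  shows "sum f I < 0"
  using sum_pos[of I "\<lambda>i. - f i"] assms by (simp add: sum_negf)

lemma sum_UNIV_split:
  fixes g :: "'n::finite \<Rightarrow> 'a::comm_monoid_add"
  shows "(\<Sum>j\<in>UNIV. g j) = g i + (\<Sum>j\<in>-{i}. g j)"
  by (subst sum.remove[of UNIV i]) (auto simp: Compl_eq_Diff_UNIV)

lemma infinitesimal_generator_row_sum:
  "infinitesimal_generator Q \<Longrightarrow> (\<Sum>j\<in>UNIV. Q $ i $ j) = 0"
  by (simp add: infinitesimal_generator_def vec_eq_iff matrix_vector_mult_def)

lemma infinitesimal_generator_diag: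
  "infinitesimal_generator Q \<Longrightarrow> Q $ i $ i = - (\<Sum>j\<in>-{i}. Q $ i $ j)"
  using infinitesimal_generator_row_sum[of Q i] sum_UNIV_split[of "\<lambda>j. Q $ i $ j" i] by simp

locale ergodic_generator =
  fixes Q :: "real^'n::finite^'n"
  assumes generator: "infinitesimal_generator Q" and ergodic: "ergodic Q"
begin

text \<open>Ergodicity enters at time 1: \<open>matrix_exp Q\<close> is then a positive stochastic
  matrix that fixes \<open>v\<close> from the left.\<close>

lemma left_kernel_sign:
  assumes "v v* Q = 0" "v $ a > 0"
  shows "v $ b > 0"
proof (rule positive_stochastic_fixed_vector_pos)
  show "matrix_exp Q $ i $ j > 0" for i j
    using ergodic[unfolded ergodic_def, rule_format, of 1 i j] by simp
  show "matrix_exp Q *v 1 = 1"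
    using generator by (intro matrix_exp_fixes_kernel) (simp add: infinitesimal_generator_def)
  show "v v* matrix_exp Q = v"
    by (rule matrix_exp_fixes_left_kernel) fact
qed fact

text \<open>The sign lemma applies to \<open>v\<close> or to \<open>- v\<close>, according to the
  sign of some nonzero entry.\<close>

lemma left_kernel_constant_sign:
  assumes "v v* Q = 0" "v \<noteq> 0"
  shows "(\<forall>i. v $ i > 0) \<or> (\<forall>i. v $ i < 0)"
proof -
  obtain a where "v $ a \<noteq> 0" using assms(2) by (auto simp: vec_eq_iff)
  moreover have "(- v) v* Q = 0"
    using assms(1) by (simp add: vec_eq_iff vector_matrix_mult_def sum_negf)
  ultimately show ?thesis
    using left_kernel_sign[OF assms(1), of a] left_kernel_sign[of "- v" a]
    by (auto simp: neq_iff)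
qed

text \<open>Existence: \<open>Q\<close> kills the vector \<open>1\<close>, so by equality of ranks
  its transpose is singular too, and a left kernel vector of constant sign can be normalised.
  Uniqueness: the difference of two solutions has zero sum, which constant sign forbids unless it is
  0.\<close>

lemma ex1_invariant_probability: "\<exists>!p. is_invariant_probability Q p"
proof -
  have "Q *v 1 = 0" using generator by (simp add: infinitesimal_generator_def)
  then have "\<exists>x. x \<noteq> 0 \<and> Q *v x = 0"
    by (intro exI[of _ 1]) (simp add: vec_eq_iff)
  then have "\<exists>x. x \<noteq> 0 \<and> transpose Q *v x = 0"
    unfolding matrix_nonfull_linear_equations_eq rank_transpose .
  then obtain v where "v \<noteq> 0" and v: "v v* Q = 0" by auto
  then have sign: "(\<forall>i. v $ i > 0) \<or> (\<forall>i. v $ i < 0)"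
    by (intro left_kernel_constant_sign)
  define s where "s = (\<Sum>i\<in>UNIV. v $ i)"
  \<comment> \<open>The total mass \<open>s\<close> has the sign of \<open>v\<close>, so dividing by
    it makes all entries positive in either case.\<close>
  define p where "p = inverse s *s v"
  have s: "s > 0 \<and> (\<forall>i. v $ i > 0) \<or> s < 0 \<and> (\<forall>i. v $ i < 0)"
    using sign by (auto simp: s_def intro!: sum_pos sum_neg)
  have "is_invariant_probability Q p"
    unfolding is_invariant_probability_def
  proof (intro conjI allI)
    show "p $ i \<ge> 0" for i
      using s by (auto simp: p_def zero_le_mult_iff less_imp_le)
    show "(\<Sum>i\<in>UNIV. p $ i) = 1"
      using s by (auto simp: p_def simp flip: sum_distrib_left s_def)
    show "transpose Q *v p = 0"
      using v by (simp add: p_def matrix_vector_mult_scaleR vector_scalar_commute)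
  qed
  moreover have "p = q" if p: "is_invariant_probability Q p" and q: "is_invariant_probability Q q" for p q
  proof (rule ccontr)
    assume "p \<noteq> q"
    moreover have "transpose Q *v (p - q) = 0"
      using p q by (simp only: is_invariant_probability_def matrix_vector_mult_diff_distrib) simp
    ultimately have "(\<forall>i. (p - q) $ i > 0) \<or> (\<forall>i. (p - q) $ i < 0)"
      by (intro left_kernel_constant_sign) auto
    then have "(\<Sum>i\<in>UNIV. (p - q) $ i) \<noteq> 0"
      by (metis UNIV_not_empty finite less_irrefl sum_neg sum_pos)
    then show False
      using p q by (simp add: is_invariant_probability_def sum_subtractf)
  qed
  ultimately show ?thesis by blast
qed

lemma invariant_probability: "is_invariant_probability Q (invariant_probability Q)"
  unfolding invariant_probability_def by (rule theI') (rule ex1_invariant_probability)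

text \<open>Strict positivity gives every row a nonzero weight, so that equality in the entropy
  bound later forces equality in each row.\<close>

lemma invariant_probability_pos: "invariant_probability Q $ i > 0"
proof -
  let ?p = "invariant_probability Q"
  have p: "?p $ i \<ge> 0" "(\<Sum>i\<in>UNIV. ?p $ i) = 1" "?p v* Q = 0" for i
    using invariant_probability by (auto simp: is_invariant_probability_def)
  from p(2) have "?p \<noteq> 0" by auto
  with p(1,3) show ?thesis
    using left_kernel_constant_sign[of ?p] by (metis not_less)
qed

end

section \<open>The entropy rate\<close>

text \<open>For positive \<open>q\<close> this is \<open>ln x \<le> x - 1\<close> at
  \<open>x = r / q\<close>, multiplied by \<open>q\<close>; for \<open>q = 0\<close> the left-hand
  side is 0.\<close>

lemma mult_one_minus_ln_le:
  fixes q r :: real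
  assumes "q \<ge> 0" "r > 0"
  shows "q * (1 - ln q + ln r) \<le> r"
proof (cases "q = 0")
  case False
  then have "q > 0" using assms by simp
  then have "ln r - ln q \<le> r / q - 1"
    using assms ln_le_minus_one[of "r / q"] by (simp add: ln_div)
  then show ?thesis using \<open>q > 0\<close> by (simp add: field_simps)
qed (use assms in simp)

text \<open>The inequality \<open>ln x \<le> x - 1\<close> is tight only at \<open>x = 1\<close>,
  and \<open>q = 0\<close> would force \<open>r = 0\<close>.\<close>

lemma mult_one_minus_ln_eq:
  fixes q r :: real
  assumes "q \<ge> 0" "r > 0" "q * (1 - ln q + ln r) = r"
  shows "q = r"
proof -
  from assms have "q > 0" by (cases "q = 0") auto
  then have "ln (r / q) = r / q - 1"
    using assms by (simp add: ln_div field_simps)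
  then have "r / q = 1"
    using \<open>q > 0\<close> assms by (intro ln_eq_minus_one) auto
  then show ?thesis using \<open>q > 0\<close> by simp
qed

lemma sum_off_diagonal:
  fixes f :: "'n::finite \<Rightarrow> 'n \<Rightarrow> 'a::comm_monoid_add"
  shows "(\<Sum>(i, j)\<in>{(i, j). i \<noteq> j}. f i j) = (\<Sum>i\<in>UNIV. \<Sum>j\<in>-{i}. f i j)"
  by (subst sum.Sigma) (auto intro!: sum.cong)

text \<open>For any potential \<open>f\<close>, the increments \<open>f j - f i\<close> average to 0
  under the stationary flow and may be added freely. The diagonal part of \<open>h1\<close> becomes
  the summand 1, as each exit rate is an off-diagonal row sum.\<close>

lemma (in ergodic_generator) h1_eq:
  fixes f :: "'n \<Rightarrow> real"
  shows "h1 Q = (\<Sum>i\<in>UNIV. invariant_probability Q $ i *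
    (\<Sum>j\<in>-{i}. Q $ i $ j * (1 - ln (Q $ i $ j) + (f j - f i))))"
proof -
  let ?p = "invariant_probability Q"
  have "?p v* Q = 0"
    using invariant_probability by (simp add: is_invariant_probability_def)
  then have col: "(\<Sum>i\<in>UNIV. ?p $ i * Q $ i $ j) = 0" for j
    by (simp add: vec_eq_iff vector_matrix_mult_def mult.commute)
  \<comment> \<open>The increment vanishes at \<open>j = i\<close>. Summing over all
    \<open>j\<close> makes the zero row sums and the invariance equation applicable.\<close>
  have "(\<Sum>j\<in>-{i}. Q $ i $ j * (f j - f i)) = (\<Sum>j\<in>UNIV. Q $ i $ j * (f j - f i))" for i
    using sum_UNIV_split[of "\<lambda>j. Q $ i $ j * (f j - f i)" i] by simp
  then have "(\<Sum>i\<in>UNIV. ?p $ i * (\<Sum>j\<in>-{i}. Q $ i $ j * (f j - f i))) =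
      (\<Sum>i\<in>UNIV. ?p $ i * (\<Sum>j\<in>UNIV. Q $ i $ j * (f j - f i)))"
    by simp
  also have "\<dots> = (\<Sum>i\<in>UNIV. \<Sum>j\<in>UNIV. ?p $ i * Q $ i $ j * f j) -
      (\<Sum>i\<in>UNIV. ?p $ i * (f i * (\<Sum>j\<in>UNIV. Q $ i $ j)))"
    by (simp add: sum_distrib_left sum_subtractf algebra_simps)
  also have "(\<Sum>i\<in>UNIV. \<Sum>j\<in>UNIV. ?p $ i * Q $ i $ j * f j) = 0"
    by (subst sum.swap) (simp add: col flip: sum_distrib_right)
  finally have flow: "(\<Sum>i\<in>UNIV. ?p $ i * (\<Sum>j\<in>-{i}. Q $ i $ j * (f j - f i))) = 0"
    by (simp add: infinitesimal_generator_row_sum[OF generator])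
  have diag: "- Q $ i $ i = (\<Sum>j\<in>-{i}. Q $ i $ j)" for i
    using infinitesimal_generator_diag[OF generator, of i] by simp
  have "h1 Q = (\<Sum>i\<in>UNIV. ?p $ i * (- Q $ i $ i)) -
      (\<Sum>i\<in>UNIV. ?p $ i * (\<Sum>j\<in>-{i}. Q $ i $ j * ln (Q $ i $ j)))"
    unfolding h1_def Let_def sum_off_diagonal
    by (simp add: sum_negf sum_distrib_left mult.assoc)
  also have "\<dots> = (\<Sum>i\<in>UNIV. ?p $ i * (\<Sum>j\<in>-{i}. Q $ i $ j)) -
      (\<Sum>i\<in>UNIV. ?p $ i * (\<Sum>j\<in>-{i}. Q $ i $ j * ln (Q $ i $ j))) +
      (\<Sum>i\<in>UNIV. ?p $ i * (\<Sum>j\<in>-{i}. Q $ i $ j * (f j - f i)))"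
    unfolding diag flow by simp
  also have "\<dots> = (\<Sum>i\<in>UNIV. ?p $ i *
      (\<Sum>j\<in>-{i}. Q $ i $ j * (1 - ln (Q $ i $ j) + (f j - f i))))"
    by (simp add: sum_subtractf sum.distrib algebra_simps)
  finally show ?thesis .
qed

section \<open>The Ruelle-Bowen generator\<close>

text \<open>\<open>matrix_inv\<close> is a Hilbert choice; uniqueness of two-sided inverses pins it
  down.\<close>

lemma matrix_inv_eqI:
  fixes M :: "real^'n^'n"
  assumes "M ** N = mat 1" "N ** M = mat 1"
  shows "matrix_inv M = N"
  unfolding matrix_inv_def
proof (rule some_equality)
  show "K = N" if "M ** K = mat 1 \<and> K ** M = mat 1" for K
    using that assms by (metis matrix_mul_assoc matrix_mul_lid matrix_mul_rid)
qed (use assms in blast)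

lemma Q_RB_nth:
  fixes A :: "real^'n^'n"
  assumes "\<forall>i. \<phi> $ i > 0"
  shows "Q_RB A \<phi> $ i $ j =
    A $ i $ j * \<phi> $ j / \<phi> $ i - (if i = j then spectral_radius A else 0)"
proof -
  have nz: "\<phi> $ i \<noteq> 0" for i using assms by (metis less_irrefl)
  define D :: "real^'n^'n" where "D = diag (\<chi> i. inverse (\<phi> $ i))"
  have diag_left: "(diag v ** M) $ i $ j = v $ i * M $ i $ j" for v and M :: "real^'n^'n" and i j
    by (simp add: diag_def matrix_matrix_mult_def if_distrib[of "\<lambda>x. x * _"] cong: if_cong)
  have diag_right: "(M ** diag v) $ i $ j = M $ i $ j * v $ j" for v and M :: "real^'n^'n" and i j
    by (simp add: diag_def matrix_matrix_mult_def if_distrib[of "\<lambda>x. _ * x"] cong: if_cong)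
  have "diag \<phi> ** D = mat 1" "D ** diag \<phi> = mat 1"
    unfolding D_def vec_eq_iff diag_left
    by (auto simp: diag_def mat_def nz)
  then have "matrix_inv (diag \<phi>) = D"
    by (rule matrix_inv_eqI)
  then show ?thesis
    by (simp add: Q_RB_def diag_left diag_right D_def mat_def divide_inverse)
qed

locale strongly_connected_graph =
  fixes E :: "'n::finite rel" and A :: "real^'n^'n" and \<phi> :: "real^'n"
  assumes card: "CARD('n) \<ge> 2"
    and irrefl: "irrefl E"
    and connected: "strongly_connected E"
    and A_def: "A = adjacency_matrix E"
    and eigenvector: "A *v \<phi> = spectral_radius A *s \<phi>"
    and pos: "\<phi> $ i > 0"
begin

lemma A_nth: "A $ i $ j = (if (i, j) \<in> E then 1 else 0)"
  by (simp add: A_def adjacency_matrix_def)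

lemma A_diag [simp]: "A $ i $ i = 0"
  using irrefl by (simp add: A_nth irrefl_def)

lemma Q_RB_off_diag: "i \<noteq> j \<Longrightarrow> Q_RB A \<phi> $ i $ j = A $ i $ j * \<phi> $ j / \<phi> $ i"
  and Q_RB_diag: "Q_RB A \<phi> $ i $ i = - spectral_radius A"
  using pos by (simp_all add: Q_RB_nth)

text \<open>Row \<open>i\<close> of the eigenvector equation, divided by the positive entry
  \<open>\<phi> $ i\<close>.\<close>

lemma rates_sum: "(\<Sum>j\<in>UNIV. A $ i $ j * \<phi> $ j / \<phi> $ i) = spectral_radius A"
proof -
  have "(\<Sum>j\<in>UNIV. A $ i $ j * \<phi> $ j) = spectral_radius A * \<phi> $ i"
    using eigenvector by (simp add: vec_eq_iff matrix_vector_mult_def)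
  then show ?thesis
    using pos[of i] by (simp flip: sum_divide_distrib)
qed

lemma rates_sum': "(\<Sum>j\<in>-{i}. Q_RB A \<phi> $ i $ j) = spectral_radius A"
proof -
  have "(\<Sum>j\<in>-{i}. Q_RB A \<phi> $ i $ j) = (\<Sum>j\<in>-{i}. A $ i $ j * \<phi> $ j / \<phi> $ i)"
    by (intro sum.cong) (auto simp: Q_RB_off_diag)
  \<comment> \<open>The absence of self loops makes the extra term \<open>j = i\<close>
    zero.\<close>
  also have "\<dots> = (\<Sum>j\<in>UNIV. A $ i $ j * \<phi> $ j / \<phi> $ i)"
    by (intro sum.mono_neutral_left) auto
  finally show ?thesis by (simp only: rates_sum)
qed

text \<open>A path between two distinct nodes has a first edge, which gives one row a positive sum
  of rates; that sum is the spectral radius.\<close>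

lemma spectral_radius_pos: "spectral_radius A > 0"
proof -
  obtain i j :: 'n where "i \<noteq> j"
    using card by (metis (full_types) card_le_Suc0_iff_eq finite not_less_eq_eq numeral_2_eq_2)
  moreover have "(i, j) \<in> E\<^sup>*"
    using connected by (simp add: strongly_connected_def)
  ultimately obtain l where "(i, l) \<in> E"
    by (metis converse_rtranclE)
  then have "(\<Sum>j\<in>UNIV. A $ i $ j * \<phi> $ j / \<phi> $ i) > 0"
    by (intro sum_pos2[of UNIV l]) (auto simp: A_nth pos less_imp_le)
  then show ?thesis by (simp only: rates_sum)
qed

lemma Q_RB_generator: "infinitesimal_generator (Q_RB A \<phi>)"
  unfolding infinitesimal_generator_def
proof (intro conjI allI impI)
  show "Q_RB A \<phi> $ i $ j \<ge> 0" if "i \<noteq> j" for i j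
    using that pos by (simp add: Q_RB_off_diag A_nth less_imp_le)
  show "Q_RB A \<phi> $ i $ i < 0" for i
    using spectral_radius_pos by (simp add: Q_RB_diag)
  have "(\<Sum>j\<in>UNIV. Q_RB A \<phi> $ i $ j) = 0" for i
    using rates_sum[of i] pos by (simp add: Q_RB_nth sum_subtractf)
  then show "Q_RB A \<phi> *v 1 = 0"
    by (simp add: vec_eq_iff matrix_vector_mult_def)
qed

text \<open>Up to a scalar shift, \<open>t *\<^sub>R Q_RB A \<phi>\<close> is a nonnegative matrix
  \<open>R\<close> that is positive on the edges, so strong connectedness supplies the required
  paths.\<close>

lemma Q_RB_ergodic: "ergodic (Q_RB A \<phi>)"
  unfolding ergodic_def
proof (intro allI impI)
  fix i j and t :: real
  assume "t > 0"
  define R :: "real^'n^'n" where "R = (\<chi> i j. t * (A $ i $ j * \<phi> $ j / \<phi> $ i))"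
  have "t *\<^sub>R Q_RB A \<phi> = R + (- t * spectral_radius A) *\<^sub>R mat 1"
    using pos by (simp add: vec_eq_iff R_def Q_RB_nth mat_def algebra_simps)
  moreover have "matrix_exp R $ i $ j > 0"
  proof (rule matrix_exp_nonneg_irreducible_pos)
    show "R $ i $ j \<ge> 0" for i j
      using \<open>t > 0\<close> pos by (simp add: R_def A_nth less_imp_le)
    have "E \<subseteq> {(i, j). R $ i $ j > 0}"
      using \<open>t > 0\<close> pos by (auto simp: R_def A_nth)
    then show "(i, j) \<in> {(i, j). R $ i $ j > 0}\<^sup>*"
      using connected rtrancl_mono unfolding strongly_connected_def by blast
  qed
  ultimately show "matrix_exp (t *\<^sub>R Q_RB A \<phi>) $ i $ j > 0"
    by (simp only: matrix_exp_add_scalar) simp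
qed

lemma Q_RB_in_graph_generators: "Q_RB A \<phi> \<in> graph_generators A"
  using Q_RB_generator Q_RB_ergodic
  by (simp add: graph_generators_def consistent_def Q_RB_off_diag)

section \<open>Optimality and uniqueness\<close>

text \<open>On an edge, the potential difference is the logarithm of the rate \<open>r\<close> of
  \<open>Q_RB\<close>, and the scalar inequality applies. Off the edges, consistency makes both
  sides 0.\<close>

lemma entropy_term_le:
  assumes "Q \<in> graph_generators A" "i \<noteq> j"
  shows "Q $ i $ j * (1 - ln (Q $ i $ j) + (ln (\<phi> $ j) - ln (\<phi> $ i))) \<le> Q_RB A \<phi> $ i $ j"
    and "Q $ i $ j * (1 - ln (Q $ i $ j) + (ln (\<phi> $ j) - ln (\<phi> $ i))) = Q_RB A \<phi> $ i $ j \<Longrightarrow>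
      Q $ i $ j = Q_RB A \<phi> $ i $ j"
proof -
  let ?q = "Q $ i $ j" and ?r = "Q_RB A \<phi> $ i $ j"
  let ?l = "?q * (1 - ln ?q + (ln (\<phi> $ j) - ln (\<phi> $ i)))"
  have q: "?q \<ge> 0" and q0: "A $ i $ j = 0 \<Longrightarrow> ?q = 0"
    using assms by (auto simp: graph_generators_def infinitesimal_generator_def consistent_def)
  have "?l \<le> ?r \<and> (?l = ?r \<longrightarrow> ?q = ?r)"
  proof (cases "(i, j) \<in> E")
    case True
    then have r: "?r = \<phi> $ j / \<phi> $ i" "?r > 0"
      using assms(2) pos by (simp_all add: Q_RB_off_diag A_nth)
    have "ln ?r = ln (\<phi> $ j) - ln (\<phi> $ i)"
      unfolding r(1) by (intro ln_divide_pos pos)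
    then show ?thesis
      using mult_one_minus_ln_le[OF q r(2)] mult_one_minus_ln_eq[OF q r(2)] by simp
  next
    case False
    then show ?thesis
      using q0 assms(2) by (simp add: A_nth Q_RB_off_diag)
  qed
  then show "?l \<le> ?r" and "?l = ?r \<Longrightarrow> ?q = ?r" by auto
qed

text \<open>The rows of off-diagonal rates of \<open>Q_RB\<close> all sum to the spectral radius, so
  averaging them under the invariant probability returns it. Subtracting \<open>h1_eq\<close> with
  \<open>f = ln \<phi>\<close> leaves a weighted sum of the gaps in
  \<open>entropy_term_le\<close>.\<close>

lemma h1_deficit:
  assumes "Q \<in> graph_generators A"
  shows "spectral_radius A - h1 Q = (\<Sum>i\<in>UNIV. \<Sum>j\<in>-{i}. invariant_probability Q $ i *
    (Q_RB A \<phi> $ i $ j - Q $ i $ j * (1 - ln (Q $ i $ j) + (ln (\<phi> $ j) - ln (\<phi> $ i)))))"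
proof -
  interpret ergodic_generator Q
    using assms by unfold_locales (auto simp: graph_generators_def)
  let ?p = "invariant_probability Q"
  have "(\<Sum>i\<in>UNIV. ?p $ i * (\<Sum>j\<in>-{i}. Q_RB A \<phi> $ i $ j)) = spectral_radius A"
    using invariant_probability
    by (simp add: rates_sum' is_invariant_probability_def flip: sum_distrib_right)
  then show ?thesis
    unfolding h1_eq[of "\<lambda>i. ln (\<phi> $ i)"]
    by (simp only: sum_distrib_left[symmetric] sum_subtractf right_diff_distrib)
qed

lemma h1_le:
  assumes "Q \<in> graph_generators A"
  shows "h1 Q \<le> spectral_radius A"
    and "h1 Q = spectral_radius A \<Longrightarrow> Q = Q_RB A \<phi>"
proof -
  interpret ergodic_generator Q
    using assms by unfold_locales (auto simp: graph_generators_def)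
  let ?p = "invariant_probability Q"
  let ?d = "\<lambda>i j. ?p $ i * (Q_RB A \<phi> $ i $ j -
    Q $ i $ j * (1 - ln (Q $ i $ j) + (ln (\<phi> $ j) - ln (\<phi> $ i))))"
  have nonneg: "?d i j \<ge> 0" if "j \<in> -{i}" for i j
    using that entropy_term_le(1)[OF assms, of i j] invariant_probability_pos[of i] by simp
  then have "(\<Sum>i\<in>UNIV. \<Sum>j\<in>-{i}. ?d i j) \<ge> 0"
    by (intro sum_nonneg) blast
  then show "h1 Q \<le> spectral_radius A"
    by (simp flip: h1_deficit[OF assms])
  assume "h1 Q = spectral_radius A"
  then have "(\<Sum>i\<in>UNIV. \<Sum>j\<in>-{i}. ?d i j) = 0"
    by (simp flip: h1_deficit[OF assms])
  then have "(\<Sum>j\<in>-{i}. ?d i j) = 0" for i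
    by (subst (asm) sum_nonneg_eq_0_iff) (auto intro!: sum_nonneg nonneg)
  then have "?d i j = 0" if "j \<in> -{i}" for i j
    using that by (intro sum_nonneg_0[OF finite nonneg])
  \<comment> \<open>The weight is positive, so the gap itself is 0 and the equality case
    applies.\<close>
  then have off: "Q $ i $ j = Q_RB A \<phi> $ i $ j" if "i \<noteq> j" for i j
    using that invariant_probability_pos[of i] entropy_term_le(2)[OF assms that]
    by (metis ComplI eq_iff_diff_eq_0 less_irrefl mult_eq_0_iff singletonD)
  have "(\<Sum>j\<in>-{i}. Q $ i $ j) = (\<Sum>j\<in>-{i}. Q_RB A \<phi> $ i $ j)" for i
    by (intro sum.cong) (auto intro: off)
  \<comment> \<open>Zero row sums let the off-diagonal entries determine the diagonal.\<close>
  then have "Q $ i $ i = Q_RB A \<phi> $ i $ i" for i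
    by (simp only: infinitesimal_generator_diag[OF generator]
        infinitesimal_generator_diag[OF Q_RB_generator])
  with off show "Q = Q_RB A \<phi>"
    unfolding vec_eq_iff by metis
qed

text \<open>Every gap in the deficit vanishes: on edges the logarithms cancel, and elsewhere the
  rate is 0.\<close>

lemma h1_Q_RB: "h1 (Q_RB A \<phi>) = spectral_radius A"
proof -
  have "Q_RB A \<phi> $ i $ j - Q_RB A \<phi> $ i $ j *
      (1 - ln (Q_RB A \<phi> $ i $ j) + (ln (\<phi> $ j) - ln (\<phi> $ i))) = 0" if "i \<noteq> j" for i j
    using that by (simp add: Q_RB_off_diag A_nth ln_divide_pos pos)
  then have "spectral_radius A - h1 (Q_RB A \<phi>) = 0"
    unfolding h1_deficit[OF Q_RB_in_graph_generators] by (intro sum.neutral ballI) (metis ComplD mult_zero_right singletonI)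
  then show ?thesis by simp
qed

end

theorem theorem1:
  fixes E :: "'n::finite rel"
    and A :: "real^'n^'n"
    and \<phi> :: "real^'n"
  assumes "CARD('n) \<ge> 2"
    and "irrefl E"
    and "strongly_connected E"
    and "A = adjacency_matrix E"
    and "A *v \<phi> = spectral_radius A *s \<phi>"
    and "\<forall>i. \<phi> $ i > 0"
  shows "{Q. is_arg_max h1 (\<lambda>Q. Q \<in> graph_generators A) Q} = {Q_RB A \<phi>} \<and>
    h1 (Q_RB A \<phi>) = spectral_radius A"
proof -
  interpret strongly_connected_graph E A \<phi>
    using assms by unfold_locales auto
  \<comment> \<open>The value at \<open>Q_RB\<close> meets the upper bound, so any maximiser attains
    it too, and the equality case of \<open>h1_le\<close> identifies it.\<close>
  have "is_arg_max h1 (\<lambda>Q. Q \<in> graph_generators A) Q \<longleftrightarrow> Q = Q_RB A \<phi>" for Q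
    unfolding is_arg_max_def
    using h1_le Q_RB_in_graph_generators h1_Q_RB by (metis less_le not_le)
  then show ?thesis
    using h1_Q_RB by blast
qed

end
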